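(* Let $A\in\mathbb{R}^{m\times n}$ and $b\in\mathbb{R}^m$ satisfy the standing assumptions in the context. Then the CGME iterate $x_k^{cgme}$ has the filtered SVD expansion $$x_k^{cgme}=\sum_{i=1}^n f_i^{(k,cgme)}\,\frac{u_i^Tb}{\sigma_i}\,v_i,\quad k=1,2,\ldots,n,$$ where the filters are $$f_i^{(k,cgme)}=1-\prod_{j=1}^k\frac{(\bar\theta_j^{(k)})^2-\sigma_i^2}{(\bar\theta_j^{(k)})^2},\quad i=1,2,\ldots,n,$$ and $\bar\theta_1^{(k)},\ldots,\bar\theta_k^{(k)}$ are the singular values of $\bar B_k$.
   Context: $\|\cdot\|$ is the 2-norm of a vector or matrix. $A\in\mathbb{R}^{m\times n}$ with $m\ge n$ has the singular value decomposition $A=U\begin{pmatrix}\Sigma\\ \mathbf{0}\end{pmatrix}V^T$ with $U=(u_1,\ldots,u_m)$ and $V=(v_1,\ldots,v_n)$ orthogonal, $\Sigma=\mathrm{diag}(\sigma_1,\ldots,\sigma_n)$ and simple singular values $\sigma_1>\sigma_2>\cdots>\sigma_n>0$; $b\in\mathbb{R}^m$ satisfies $u_i^Tb\neq 0$ for $i=1,\ldots,n$. Lanczos bidiagonalization: set $\beta_1=\|b\|$, $p_1=b/\|b\|$, and $\beta_1q_0$ is taken to be $\mathbf{0}$. For $j=1,2,\ldots$: $r=A^Tp_j-\beta_jq_{j-1}$, $\alpha_j=\|r\|$, $q_j=r/\alpha_j$; $z=Aq_j-\alpha_jp_j$, $\beta_{j+1}=\|z\|$, $p_{j+1}=z/\beta_{j+1}$.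 The vectors $q_1,q_2,\ldots$ are orthonormal, and so are $p_1,p_2,\ldots$. Standing assumption: the process does not break down before step $n$, i.e. $\alpha_1,\ldots,\alpha_n>0$ and $\beta_2,\ldots,\beta_n>0$; moreover $\beta_{n+1}>0$ if $m>n$, while necessarily $\beta_{n+1}=0$ if $m=n$. Write $P_k=(p_1,\ldots,p_k)$, $Q_k=(q_1,\ldots,q_k)$, and let $\bar B_k=P_k^TAQ_k\in\mathbb{R}^{k\times k}$, the lower bidiagonal matrix with diagonal $\alpha_1,\ldots,\alpha_k$ and subdiagonal $\beta_2,\ldots,\beta_k$. CGME is the conjugate gradient method implicitly applied to $\min\|AA^Ty-b\|$ or $AA^Ty=b$ with $x=A^Ty$ and zero starting vector; its $k$-th iterate is $$x_k^{cgme}=Q_ky_k^{cgme},\qquad y_k^{cgme}=\beta_1\bar B_k^{-1}e_1^{(k)},$$ with $e_1^{(k)}$ the first canonical basis vector of $\mathbb{R}^k$; equivalently $x_k^{cgme}=Q_k\bar B_k^{-1}P_k^Tb$. *)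

theory Defs
  imports Complex_Main "Jordan_Normal_Form.Gauss_Jordan_Elimination"
begin

definition vec_norm2 :: "real vec \<Rightarrow> real" where
  "vec_norm2 v = sqrt (v \<bullet> v)"

(* The constant orthogonal_mat of Jordan_Normal_Form.Matrix only asks for pairwise orthogonal,
   not necessarily normalised, columns. *)
definition real_orthogonal :: "nat \<Rightarrow> real mat \<Rightarrow> bool" where
  "real_orthogonal n U \<longleftrightarrow>
     U \<in> carrier_mat n n \<and> transpose_mat U * U = 1\<^sub>m n \<and> U * transpose_mat U = 1\<^sub>m n"

definition rect_diag :: "nat \<Rightarrow> nat \<Rightarrow> (nat \<Rightarrow> real) \<Rightarrow> real mat" where
  "rect_diag m n s = mat m n (\<lambda>(i, j). if i = j then s i else 0)"

(* Intended for m >= n. The singular values are s 0, ..., s (n - 1), listed with multiplicity;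
   no order is imposed here. Rows and columns of matrices are indexed from 0, so the i-th
   singular vectors are col U (i - 1) and col V (i - 1). *)
definition is_svd ::
  "nat \<Rightarrow> nat \<Rightarrow> real mat \<Rightarrow> real mat \<Rightarrow> (nat \<Rightarrow> real) \<Rightarrow> real mat \<Rightarrow> bool" where
  "is_svd m n A U s V \<longleftrightarrow>
     A \<in> carrier_mat m n \<and> real_orthogonal m U \<and> real_orthogonal n V \<and>
     (\<forall>i<n. 0 \<le> s i) \<and> A = U * rect_diag m n s * transpose_mat V"

definition singular_values_of :: "nat \<Rightarrow> real mat \<Rightarrow> (nat \<Rightarrow> real) \<Rightarrow> bool" where
  "singular_values_of k B s \<longleftrightarrow> (\<exists>X Y. is_svd k k B X s Y)"

definition lb_step ::
  "real mat \<Rightarrow> real \<times> real vec \<times> real \<times> real vec \<Rightarrow> real \<times> real vec \<times> real \<times> real vec" where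
  "lb_step A = (\<lambda>(_, q, \<beta>, p).
     let r = transpose_mat A *\<^sub>v p - \<beta> \<cdot>\<^sub>v q;
         \<alpha> = vec_norm2 r;
         q' = (1 / \<alpha>) \<cdot>\<^sub>v r;
         z = A *\<^sub>v q' - \<alpha> \<cdot>\<^sub>v p;
         \<beta>' = vec_norm2 z
     in (\<alpha>, q', \<beta>', (1 / \<beta>') \<cdot>\<^sub>v z))"

(* The j-th state is (alpha_j, q_j, beta_(j+1), p_(j+1)); alpha_0 is a dummy and q_0 = 0.
   Since division by 0 yields 0, the sequences consist of zeros after a breakdown. *)
primrec lb_state :: "real mat \<Rightarrow> real vec \<Rightarrow> nat \<Rightarrow> real \<times> real vec \<times> real \<times> real vec" where
  "lb_state A b 0 = (0, 0\<^sub>v (dim_col A), vec_norm2 b, (1 / vec_norm2 b) \<cdot>\<^sub>v b)"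
| "lb_state A b (Suc j) = lb_step A (lb_state A b j)"

definition lb_alpha :: "real mat \<Rightarrow> real vec \<Rightarrow> nat \<Rightarrow> real" where
  "lb_alpha A b j = fst (lb_state A b j)"

definition lb_q :: "real mat \<Rightarrow> real vec \<Rightarrow> nat \<Rightarrow> real vec" where
  "lb_q A b j = fst (snd (lb_state A b j))"

(* Only meaningful for j >= 1, like lb_p. *)
definition lb_beta :: "real mat \<Rightarrow> real vec \<Rightarrow> nat \<Rightarrow> real" where
  "lb_beta A b j = fst (snd (snd (lb_state A b (j - 1))))"

definition lb_p :: "real mat \<Rightarrow> real vec \<Rightarrow> nat \<Rightarrow> real vec" where
  "lb_p A b j = snd (snd (snd (lb_state A b (j - 1))))"

lemma lb_initial:
  "lb_q A b 0 = 0\<^sub>v (dim_col A)"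
  "lb_beta A b 1 = vec_norm2 b"
  "lb_p A b 1 = (1 / vec_norm2 b) \<cdot>\<^sub>v b"
  by (simp_all add: lb_q_def lb_beta_def lb_p_def)

lemma lb_recurrence:
  fixes A :: "real mat" and b :: "real vec"
  assumes "j \<ge> 1"
  defines "r \<equiv> transpose_mat A *\<^sub>v lb_p A b j - lb_beta A b j \<cdot>\<^sub>v lb_q A b (j - 1)"
  defines "z \<equiv> A *\<^sub>v lb_q A b j - lb_alpha A b j \<cdot>\<^sub>v lb_p A b j"
  shows "lb_alpha A b j = vec_norm2 r"
    and "lb_q A b j = (1 / lb_alpha A b j) \<cdot>\<^sub>v r"
    and "lb_beta A b (j + 1) = vec_norm2 z"
    and "lb_p A b (j + 1) = (1 / lb_beta A b (j + 1)) \<cdot>\<^sub>v z"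
  using assms(1) unfolding r_def z_def
  by (cases j; simp add: lb_alpha_def lb_q_def lb_beta_def lb_p_def lb_step_def Let_def
        split: prod.split)+

definition lb_P :: "real mat \<Rightarrow> real vec \<Rightarrow> nat \<Rightarrow> real mat" where
  "lb_P A b k = mat_of_cols (dim_row A) (map (lb_p A b) [1..<k + 1])"

definition lb_Q :: "real mat \<Rightarrow> real vec \<Rightarrow> nat \<Rightarrow> real mat" where
  "lb_Q A b k = mat_of_cols (dim_col A) (map (lb_q A b) [1..<k + 1])"

definition lb_B :: "real mat \<Rightarrow> real vec \<Rightarrow> nat \<Rightarrow> real mat" where
  "lb_B A b k = transpose_mat (lb_P A b k) * A * lb_Q A b k"

definition cgme_y :: "real mat \<Rightarrow> real vec \<Rightarrow> nat \<Rightarrow> real vec" where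
  "cgme_y A b k = lb_beta A b 1 \<cdot>\<^sub>v (the (mat_inverse (lb_B A b k)) *\<^sub>v unit_vec k 0)"

definition cgme_x :: "real mat \<Rightarrow> real vec \<Rightarrow> nat \<Rightarrow> real vec" where
  "cgme_x A b k = lb_Q A b k *\<^sub>v cgme_y A b k"

definition cgme_filter :: "(nat \<Rightarrow> real) \<Rightarrow> nat \<Rightarrow> (nat \<Rightarrow> real) \<Rightarrow> nat \<Rightarrow> real" where
  "cgme_filter \<sigma> k \<theta> i = 1 - (\<Prod>j<k. ((\<theta> j)\<^sup>2 - (\<sigma> i)\<^sup>2) / (\<theta> j)\<^sup>2)"

end

theory Submission
  imports Defs "Jordan_Normal_Form.Determinant"
begin

text \<open>
  Write \<open>M = A A\<^sup>T\<close> and \<open>T = B B\<^sup>T\<close>, where \<open>B = P\<^sup>T A Q\<close> is the lower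
  bidiagonal matrix after \<open>k\<close> Lanczos steps and the Lanczos vectors are the columns of \<open>P\<close> and \<open>Q\<close>.  Let \<open>\<chi>(t) = \<Prod>\<^sub>j (\<theta>\<^sub>j\<^sup>2 - t) / \<theta>\<^sub>j\<^sup>2\<close>
  be the characteristic polynomial of \<open>T\<close>, normalised at \<open>0\<close>.  Since \<open>\<chi>(T) = 0\<close>, the polynomial
  \<open>\<phi>(t) = (1 - \<chi>(t)) / t\<close> of degree \<open>k - 1\<close> satisfies \<open>T\<^sup>-\<^sup>1 = \<phi>(T)\<close>, and the
  Krylov structure of the Lanczos vectors turns \<open>P \<phi>(T) \<beta>\<^sub>1 e\<^sub>1\<close> into
  \<open>\<phi>(M) b\<close>.  Hence the CGME iterate is \<open>A\<^sup>T \<phi>(M) b\<close>, whose coefficient along \<open>v\<^sub>i\<close> is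
  \<open>(1 - \<chi>(\<sigma>\<^sub>i\<^sup>2)) / \<sigma>\<^sub>i\<close> times \<open>u\<^sub>i \<bullet> b\<close>, as asserted.

  Matrix polynomials are avoided by evaluating \<open>\<phi>\<close> factor by factor: \<open>\<phi>(M) b\<close> is the result of \<open>k\<close>
  Richardson steps for \<open>M y = b\<close> with step sizes \<open>1 / \<theta>\<^sub>j\<^sup>2\<close>, because every step multiplies the
  residual by \<open>I - M / \<theta>\<^sub>j\<^sup>2\<close> (lemma \<open>richardson_residual\<close>).
  Applied to \<open>B\<close>, the iteration solves \<open>T y = \<beta>\<^sub>1 e\<^sub>1\<close> exactly after \<open>k\<close> steps
  (\<open>richardson_terminates\<close>).  The iterates for \<open>A\<close> and \<open>b\<close> are the images under \<open>P\<close> of those for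
  \<open>B\<close> and \<open>\<beta>\<^sub>1 e\<^sub>1\<close> up to step \<open>k\<close> (\<open>richardson_projected\<close>).  Therefore the CGME iterate is
  \<open>A\<^sup>T\<close> applied to the \<open>k\<close>-th Richardson iterate (\<open>cgme_x_eq_richardson\<close>), and its coefficients
  in the basis \<open>V\<close> are read off from the residual.
\<close>

section \<open>Singular vectors\<close>

lemma mult_mat_unit_vec:
  fixes U :: "real mat"
  assumes "U \<in> carrier_mat m n" "i < n"
  shows "U *\<^sub>v unit_vec n i = col U i"
  using assms by (intro eq_vecI) (auto simp: scalar_prod_right_unit)

lemma mult_mat_zero_vec:
  fixes A :: "real mat"
  assumes "A \<in> carrier_mat m n"
  shows "A *\<^sub>v 0\<^sub>v n = 0\<^sub>v m"
  using assms by (intro eq_vecI) auto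

lemma is_svd_triplets:
  assumes svd: "is_svd m n A U s V" and "n \<le> m" "i < n"
  shows "A *\<^sub>v col V i = s i \<cdot>\<^sub>v col U i"
    and "transpose_mat A *\<^sub>v col U i = s i \<cdot>\<^sub>v col V i"
proof -
  let ?D = "rect_diag m n s"
  have c: "U \<in> carrier_mat m m" "V \<in> carrier_mat n n" "A \<in> carrier_mat m n"
    "?D \<in> carrier_mat m n"
    and A: "A = U * ?D * transpose_mat V"
    and UU: "transpose_mat U * U = 1\<^sub>m m" and VV: "transpose_mat V * V = 1\<^sub>m n"
    using svd by (auto simp: is_svd_def real_orthogonal_def rect_diag_def)
  have "A * V = U * ?D * (transpose_mat V * V)"
    unfolding A by (rule assoc_mult_mat) (use c in auto)
  also have "\<dots> = U * ?D"
    using c by (auto simp: VV)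
  finally have "A *\<^sub>v col V i = U *\<^sub>v col ?D i"
    using c \<open>i < n\<close> col_mult2[of A m n V n i] col_mult2[of U m m ?D n i]
    by (simp del: col_mult)
  also have "col ?D i = s i \<cdot>\<^sub>v unit_vec m i"
    using assms by (intro eq_vecI) (auto simp: rect_diag_def)
  finally show "A *\<^sub>v col V i = s i \<cdot>\<^sub>v col U i"
    using c assms by (simp add: mult_mat_vec[of _ m m] mult_mat_unit_vec)
  have "transpose_mat A = V * (transpose_mat ?D * transpose_mat U)"
    unfolding A using c
    by (subst transpose_mult[of _ m n _ n], auto, subst transpose_mult[of _ m m], auto)
  hence "transpose_mat A * U = V * transpose_mat ?D * (transpose_mat U * U)"
    using c by (simp add: assoc_mult_mat[of _ n n _ m _ m] assoc_mult_mat[of _ n m _ m _ m])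
  also have "\<dots> = V * transpose_mat ?D"
    using c unfolding UU by (intro right_mult_one_mat[of _ n]) auto
  finally have "transpose_mat A * U = V * transpose_mat ?D" .
  hence "transpose_mat A *\<^sub>v col U i = V *\<^sub>v col (transpose_mat ?D) i"
    using c assms col_mult2[of "transpose_mat A" n m U m i] col_mult2[of V n n "transpose_mat ?D" m i]
    by (simp del: col_mult)
  also have "col (transpose_mat ?D) i = s i \<cdot>\<^sub>v unit_vec n i"
    using assms by (intro eq_vecI) (auto simp: rect_diag_def)
  finally show "transpose_mat A *\<^sub>v col U i = s i \<cdot>\<^sub>v col V i"
    using c assms by (simp add: mult_mat_vec[of _ n n] mult_mat_unit_vec)
qed

lemma is_svd_coefficients:
  assumes svd: "is_svd m n A U s V" and le: "n \<le> m" and i: "i < n"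
  shows "x \<in> carrier_vec n \<Longrightarrow> col U i \<bullet> (A *\<^sub>v x) = s i * (col V i \<bullet> x)"
    and "y \<in> carrier_vec m \<Longrightarrow> col V i \<bullet> (transpose_mat A *\<^sub>v y) = s i * (col U i \<bullet> y)"
proof -
  have c: "U \<in> carrier_mat m m" "V \<in> carrier_mat n n" "A \<in> carrier_mat m n"
    using svd unfolding is_svd_def real_orthogonal_def by blast+
  have cols: "col U i \<in> carrier_vec m" "col V i \<in> carrier_vec n"
    using c le i by auto
  show "col U i \<bullet> (A *\<^sub>v x) = s i * (col V i \<bullet> x)" if "x \<in> carrier_vec n"
    using transpose_vec_mult_scalar[OF c(3) that cols(1)] is_svd_triplets(2)[OF assms] that cols
    by (simp add: smult_scalar_prod_distrib[of _ n])
  show "col V i \<bullet> (transpose_mat A *\<^sub>v y) = s i * (col U i \<bullet> y)" if "y \<in> carrier_vec m"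
    using transpose_vec_mult_scalar[of "transpose_mat A" n m y "col V i"]
      is_svd_triplets(1)[OF assms] that cols c
    by (simp add: smult_scalar_prod_distrib[of _ m])
qed

lemma real_orthogonal_expansion:
  assumes V: "real_orthogonal n V" and x: "x \<in> carrier_vec n" and "j < n"
  shows "x $ j = (\<Sum>i<n. (col V i \<bullet> x) * col V i $ j)"
proof -
  have c: "V \<in> carrier_mat n n" and VV: "V * transpose_mat V = 1\<^sub>m n"
    using V by (auto simp: real_orthogonal_def)
  have "x = (V * transpose_mat V) *\<^sub>v x"
    using x by (simp add: VV)
  also have "\<dots> = V *\<^sub>v (transpose_mat V *\<^sub>v x)"
    using c x by (intro assoc_mult_mat_vec[of _ n n _ n]) auto
  finally have "x $ j = row V j \<bullet> (transpose_mat V *\<^sub>v x)"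
    using c \<open>j < n\<close> by (metis carrier_matD(1) index_mult_mat_vec)
  also have "\<dots> = (\<Sum>i<n. (col V i \<bullet> x) * col V i $ j)"
    unfolding scalar_prod_def[of "row V j"] using c \<open>j < n\<close>
    by (intro sum.cong) (auto simp: mult.commute)
  finally show ?thesis .
qed

section \<open>Richardson iteration for the normal equations of the second kind\<close>

text \<open>Richardson's method for \<open>A A\<^sup>T y = b\<close>, started at \<open>y = 0\<close>, where step \<open>j\<close> adds the current
  residual divided by \<open>\<theta>\<^sub>j\<^sup>2\<close>.\<close>

primrec richardson :: "real mat \<Rightarrow> real vec \<Rightarrow> (nat \<Rightarrow> real) \<Rightarrow> nat \<Rightarrow> real vec" where
  "richardson A b \<theta> 0 = 0\<^sub>v (dim_row A)"
| "richardson A b \<theta> (Suc j) = richardson A b \<theta> j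
     + (1 / (\<theta> j)\<^sup>2) \<cdot>\<^sub>v (b - A *\<^sub>v (transpose_mat A *\<^sub>v richardson A b \<theta> j))"

lemma richardson_carrier:
  assumes "A \<in> carrier_mat m n" "b \<in> carrier_vec m"
  shows "richardson A b \<theta> j \<in> carrier_vec m"
  using assms by (induction j) auto

text \<open>The left singular vector \<open>u\<^sub>i\<close> is an eigenvector of \<open>A A\<^sup>T\<close> for \<open>s\<^sub>i\<^sup>2\<close>, so each step
  multiplies the component of the residual along it by \<open>1 - s\<^sub>i\<^sup>2 / \<theta>\<^sub>l\<^sup>2\<close>.\<close>

lemma richardson_residual:
  assumes svd: "is_svd m n A U s V" and le: "n \<le> m" and i: "i < n"
    and b: "b \<in> carrier_vec m" and \<theta>: "\<And>l. l < j \<Longrightarrow> \<theta> l \<noteq> 0"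
  shows "col U i \<bullet> (b - A *\<^sub>v (transpose_mat A *\<^sub>v richardson A b \<theta> j))
    = (\<Prod>l<j. ((\<theta> l)\<^sup>2 - (s i)\<^sup>2) / (\<theta> l)\<^sup>2) * (col U i \<bullet> b)"
proof -
  have c: "U \<in> carrier_mat m m" "V \<in> carrier_mat n n" and A: "A \<in> carrier_mat m n"
    using svd unfolding is_svd_def real_orthogonal_def by blast+
  have u: "col U i \<in> carrier_vec m"
    using c le i by auto
  define g where "g = richardson A b \<theta>"
  have g: "g j \<in> carrier_vec m" for j
    unfolding g_def by (rule richardson_carrier[OF A b])
  have AA: "A *\<^sub>v (transpose_mat A *\<^sub>v y) \<in> carrier_vec m" for y
    using A by (simp add: carrier_dim_vec)
  have res: "col U i \<bullet> (b - A *\<^sub>v (transpose_mat A *\<^sub>v y)) = col U i \<bullet> b - (s i)\<^sup>2 * (col U i \<bullet> y)"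
    if "y \<in> carrier_vec m" for y
    using that A b u AA[of y] is_svd_coefficients(1)[OF svd le i, of "transpose_mat A *\<^sub>v y"]
      is_svd_coefficients(2)[OF svd le i, of y]
    by (simp add: scalar_prod_minus_distrib[of _ m] power2_eq_square)
  have "col U i \<bullet> b - (s i)\<^sup>2 * (col U i \<bullet> g j)
      = (\<Prod>l<j. ((\<theta> l)\<^sup>2 - (s i)\<^sup>2) / (\<theta> l)\<^sup>2) * (col U i \<bullet> b)"
    using \<theta>
  proof (induction j)
    case 0
    then show ?case using u A by (simp add: g_def)
  next
    case (Suc j)
    have "col U i \<bullet> g (Suc j) = col U i \<bullet> g j
        + (1 / (\<theta> j)\<^sup>2) * (col U i \<bullet> b - (s i)\<^sup>2 * (col U i \<bullet> g j))"
    proof -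
      let ?r = "b - A *\<^sub>v (transpose_mat A *\<^sub>v g j)"
      have r: "?r \<in> carrier_vec m"
        using b AA[of "g j"] by simp
      have "g (Suc j) = g j + (1 / (\<theta> j)\<^sup>2) \<cdot>\<^sub>v ?r"
        by (simp add: g_def)
      also have "col U i \<bullet> \<dots> = col U i \<bullet> g j + (1 / (\<theta> j)\<^sup>2) * (col U i \<bullet> ?r)"
        using u g[of j] r
        by (simp add: scalar_prod_add_distrib[of _ m] scalar_prod_smult_distrib[of _ m])
      finally show ?thesis
        unfolding res[OF g] .
    qed
    hence "col U i \<bullet> b - (s i)\<^sup>2 * (col U i \<bullet> g (Suc j))
        = ((\<theta> j)\<^sup>2 - (s i)\<^sup>2) / (\<theta> j)\<^sup>2 * (col U i \<bullet> b - (s i)\<^sup>2 * (col U i \<bullet> g j))"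
      using Suc.prems[of j] by (simp only:) (simp add: field_simps)
    with Suc show ?case by simp
  qed
  thus ?thesis
    using res[OF g] by (simp add: g_def)
qed

text \<open>With the singular values of a square matrix as parameters, step \<open>i\<close> annihilates the component
  of the residual along \<open>u\<^sub>i\<close>, and the other steps keep it zero; this is the Cayley-Hamilton
  theorem for \<open>B B\<^sup>T\<close>.\<close>

lemma richardson_terminates:
  assumes svd: "is_svd k k B X \<theta> Y" and b: "b \<in> carrier_vec k"
    and \<theta>: "\<And>l. l < k \<Longrightarrow> \<theta> l \<noteq> 0"
  shows "B *\<^sub>v (transpose_mat B *\<^sub>v richardson B b \<theta> k) = b"
proof -
  define r where "r = b - B *\<^sub>v (transpose_mat B *\<^sub>v richardson B b \<theta> k)"
  have B: "B \<in> carrier_mat k k" and X: "real_orthogonal k X"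
    using svd unfolding is_svd_def by blast+
  have r: "r \<in> carrier_vec k"
    unfolding r_def using b B
    by (intro minus_carrier_vec mult_mat_vec_carrier[of _ k k] richardson_carrier) auto
  have "col X i \<bullet> r = 0" if "i < k" for i
  proof -
    have "(\<Prod>l<k. ((\<theta> l)\<^sup>2 - (\<theta> i)\<^sup>2) / (\<theta> l)\<^sup>2) = 0"
      using that by (intro prod_zero) auto
    thus ?thesis
      using richardson_residual[OF svd order.refl that b, of k \<theta>] \<theta> by (simp add: r_def)
  qed
  hence "r $ j = 0" if "j < k" for j
    using real_orthogonal_expansion[OF X r that] by simp
  thus ?thesis
    using b B r unfolding r_def by (intro eq_vecI) auto
qed

section \<open>Orthonormality of the Lanczos vectors\<close>

lemma vec_diff_eqD:
  fixes x y z :: "real vec"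
  assumes "z = x - y" "x \<in> carrier_vec m" "y \<in> carrier_vec m"
  shows "x = y + z"
  unfolding assms(1) using assms(2,3) by (intro eq_vecI) auto

lemma vec_norm2_pos:
  assumes v: "v \<in> carrier_vec m" "v \<noteq> 0\<^sub>v m"
  shows "0 < vec_norm2 v"
proof -
  obtain i where i: "i < m" "v $ i \<noteq> 0"
    using v by (metis carrier_vecD eq_vecI index_zero_vec)
  have "0 < (\<Sum>i\<in>{0..<m}. v $ i * v $ i)"
    using i by (intro sum_pos2[of _ i]) (auto simp: zero_less_mult_iff linorder_neq_iff)
  moreover have "v \<bullet> v = (\<Sum>i\<in>{0..<m}. v $ i * v $ i)"
    unfolding scalar_prod_def carrier_vecD[OF v(1)] ..
  ultimately show ?thesis by (simp add: vec_norm2_def)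
qed

lemma vec_norm2_normalize:
  assumes c: "0 < c" "c = vec_norm2 v" and w: "w = (1 / c) \<cdot>\<^sub>v v"
  shows "w \<bullet> w = 1"
proof -
  have vv: "v \<bullet> v = c\<^sup>2"
    using c(1) unfolding c(2) vec_norm2_def by simp
  have "w \<bullet> w = (1 / c) * ((1 / c) * (v \<bullet> v))"
    unfolding w by simp
  also have "\<dots> = 1"
    unfolding vv using c(1) by (simp add: power2_eq_square)
  finally show ?thesis .
qed

text \<open>The bidiagonalization of \<open>A\<close> started at \<open>b\<close>, run for \<open>k\<close> steps without breakdown.
  Positivity of \<open>\<beta>\<^sub>1\<close> says that \<open>b\<close> is nonzero; nothing is required of \<open>\<beta>\<^sub>k\<^sub>+\<^sub>1\<close>.\<close>

locale lanczos_bidiagonalization =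
  fixes A :: "real mat" and b :: "real vec" and m n k :: nat
  assumes A: "A \<in> carrier_mat m n" and b: "b \<in> carrier_vec m"
    and alpha_pos: "\<And>j. 1 \<le> j \<Longrightarrow> j \<le> k \<Longrightarrow> 0 < lb_alpha A b j"
    and beta_pos: "\<And>j. 1 \<le> j \<Longrightarrow> j \<le> k \<Longrightarrow> 0 < lb_beta A b j"
    and k_pos: "1 \<le> k"
begin

abbreviation "\<alpha> \<equiv> lb_alpha A b"
abbreviation "\<beta> \<equiv> lb_beta A b"
abbreviation "p \<equiv> lb_p A b"
abbreviation "q \<equiv> lb_q A b"
abbreviation "P \<equiv> lb_P A b k"
abbreviation "Q \<equiv> lb_Q A b k"
abbreviation "B \<equiv> lb_B A b k"

lemma p_q_carrier: "p (Suc j) \<in> carrier_vec m" "q j \<in> carrier_vec n"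
proof (induction j)
  case 0
  show "p (Suc 0) \<in> carrier_vec m"
    using b unfolding One_nat_def[symmetric] lb_initial(3) by simp
  show "q 0 \<in> carrier_vec n"
    using A unfolding lb_initial(1) by simp
next
  case (Suc j)
  have "transpose_mat A *\<^sub>v p (Suc j) \<in> carrier_vec n"
    by (rule mult_mat_vec_carrier[OF _ Suc(1)]) (use A in simp)
  moreover have "q (Suc j) = (1 / \<alpha> (Suc j)) \<cdot>\<^sub>v
      (transpose_mat A *\<^sub>v p (Suc j) - \<beta> (Suc j) \<cdot>\<^sub>v q (Suc j - 1))"
    by (rule lb_recurrence(2)) simp
  ultimately show q: "q (Suc j) \<in> carrier_vec n"
    using Suc(2) by (simp only: diff_Suc_1 smult_carrier_vec minus_carrier_vec)
  have "p (Suc j + 1) = (1 / \<beta> (Suc j + 1)) \<cdot>\<^sub>v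
      (A *\<^sub>v q (Suc j) - \<alpha> (Suc j) \<cdot>\<^sub>v p (Suc j))"
    by (rule lb_recurrence(4)) simp
  thus "p (Suc (Suc j)) \<in> carrier_vec m"
    using Suc(1) mult_mat_vec_carrier[OF A q]
    by (simp only: Suc_eq_plus1[symmetric] smult_carrier_vec minus_carrier_vec)
qed

lemma p_carrier: "1 \<le> j \<Longrightarrow> p j \<in> carrier_vec m"
  using p_q_carrier(1)[of "j - 1"] by simp

lemma q_carrier: "q j \<in> carrier_vec n"
  by (rule p_q_carrier)

lemma A_mult_q:
  assumes "1 \<le> j" "j < k"
  shows "A *\<^sub>v q j = \<alpha> j \<cdot>\<^sub>v p j + \<beta> (Suc j) \<cdot>\<^sub>v p (Suc j)"
proof -
  let ?z = "A *\<^sub>v q j - \<alpha> j \<cdot>\<^sub>v p j"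
  have "\<beta> (Suc j) \<noteq> 0" using beta_pos[of "Suc j"] assms by simp
  hence "\<beta> (Suc j) \<cdot>\<^sub>v ((1 / \<beta> (Suc j)) \<cdot>\<^sub>v ?z) = ?z"
    unfolding smult_smult_assoc by simp
  also have "(1 / \<beta> (Suc j)) \<cdot>\<^sub>v ?z = p (Suc j)"
    using lb_recurrence(4)[OF assms(1), of A b, symmetric] unfolding Suc_eq_plus1 .
  finally have "\<beta> (Suc j) \<cdot>\<^sub>v p (Suc j) = ?z" .
  thus ?thesis
    by (rule vec_diff_eqD[of _ _ _ m])
      (use p_carrier[OF assms(1)] in \<open>auto intro: mult_mat_vec_carrier[OF A q_carrier]\<close>)
qed

lemma At_mult_p:
  assumes "1 \<le> j" "j \<le> k"
  shows "transpose_mat A *\<^sub>v p j = \<alpha> j \<cdot>\<^sub>v q j + \<beta> j \<cdot>\<^sub>v q (j - 1)"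
proof -
  let ?r = "transpose_mat A *\<^sub>v p j - \<beta> j \<cdot>\<^sub>v q (j - 1)"
  have "\<alpha> j \<noteq> 0" using alpha_pos[of j] assms by simp
  hence "\<alpha> j \<cdot>\<^sub>v ((1 / \<alpha> j) \<cdot>\<^sub>v ?r) = ?r"
    unfolding smult_smult_assoc by simp
  also have "(1 / \<alpha> j) \<cdot>\<^sub>v ?r = q j"
    by (rule lb_recurrence(2)[OF assms(1), symmetric])
  finally have "\<alpha> j \<cdot>\<^sub>v q j = ?r" .
  hence "transpose_mat A *\<^sub>v p j = \<beta> j \<cdot>\<^sub>v q (j - 1) + \<alpha> j \<cdot>\<^sub>v q j"
    by (rule vec_diff_eqD[of _ _ _ n])
      (use A p_carrier[OF assms(1)] q_carrier in
        \<open>auto intro: mult_mat_vec_carrier[of _ n m]\<close>)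
  thus ?thesis
    using q_carrier by (simp add: comm_add_vec[of _ n])
qed

lemma p_unit:
  assumes "1 \<le> j" "j \<le> k"
  shows "p j \<bullet> p j = 1"
proof (cases "j = 1")
  case True
  show ?thesis
    using beta_pos[OF assms] lb_initial(2,3)[of A b] unfolding True
    by (intro vec_norm2_normalize[of "\<beta> 1" b]) auto
next
  case False
  define i where "i = j - 1"
  have i: "j = i + 1" "1 \<le> i" using assms False by (auto simp: i_def)
  show ?thesis
    using beta_pos[OF assms] lb_recurrence(3,4)[OF i(2), of A b] unfolding i(1)
    by (rule vec_norm2_normalize)
qed

lemma q_unit:
  assumes "1 \<le> j" "j \<le> k"
  shows "q j \<bullet> q j = 1"
  using alpha_pos[OF assms] lb_recurrence(1,2)[OF assms(1), of A b]
  by (rule vec_norm2_normalize)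

lemma A_adjoint:
  assumes "1 \<le> i"
  shows "(A *\<^sub>v q j) \<bullet> p i = q j \<bullet> (transpose_mat A *\<^sub>v p i)"
proof -
  have c: "A *\<^sub>v q j \<in> carrier_vec m" "transpose_mat A *\<^sub>v p i \<in> carrier_vec n"
    using A by (auto simp: carrier_dim_vec)
  show ?thesis
    using transpose_vec_mult_scalar[OF A q_carrier p_carrier[OF assms], of j]
      comm_scalar_prod[OF c(1) p_carrier[OF assms]] comm_scalar_prod[OF c(2) q_carrier] by simp
qed

text \<open>The two families have to be treated together: in the step for \<open>p\<^sub>j\<^sub>+\<^sub>1\<close> the adjoint relation
  reduces \<open>A q\<^sub>j \<bullet> p\<^sub>i\<close> to inner products of the \<open>q\<close>, and in the step for \<open>q\<^sub>j\<^sub>+\<^sub>1\<close> it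
  reduces \<open>q\<^sub>i \<bullet> A\<^sup>T p\<^sub>j\<^sub>+\<^sub>1\<close> to inner products of the \<open>p\<close>, including the new one.\<close>

lemma orthonormal_upto:
  assumes "j \<le> k" "i \<in> {1..j}" "l \<in> {1..j}"
  shows "p i \<bullet> p l = (if i = l then 1 else 0) \<and> q i \<bullet> q l = (if i = l then 1 else 0)"
  using assms
proof (induction j arbitrary: i l)
  case 0
  thus ?case by simp
next
  case (Suc j)
  have IH: "p i \<bullet> p l = (if i = l then 1 else 0)" "q i \<bullet> q l = (if i = l then 1 else 0)"
    if "i \<in> {1..j}" "l \<in> {1..j}" for i l
    using Suc.IH[of i l] Suc.prems(1) that by auto
  have pp: "p (Suc j) \<bullet> p i = 0" if i: "i \<in> {1..j}" for i
  proof -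
    have j: "1 \<le> j" "j < k" using i Suc.prems by auto
    \<comment> \<open>For \<open>i = 1\<close> this is the convention \<open>q\<^sub>0 = 0\<close>; otherwise \<open>i - 1 < j\<close>.\<close>
    have q0: "q j \<bullet> q (i - 1) = 0"
    proof (cases "i = 1")
      case True
      thus ?thesis using q_carrier[of j] A lb_initial(1)[of A b] by simp
    next
      case False
      hence "i - 1 \<in> {1..j}" "i - 1 \<noteq> j" using i by auto
      thus ?thesis using IH(2)[of j "i - 1"] j by auto
    qed
    have "(A *\<^sub>v q j) \<bullet> p i = q j \<bullet> (\<alpha> i \<cdot>\<^sub>v q i + \<beta> i \<cdot>\<^sub>v q (i - 1))"
      using A_adjoint[of i j] At_mult_p[of i] i j by auto
    also have "\<dots> = \<alpha> i * (q j \<bullet> q i)"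
      using q_carrier q0
      by (simp add: scalar_prod_add_distrib[of _ n] scalar_prod_smult_distrib[of _ n])
    also have "(A *\<^sub>v q j) \<bullet> p i = \<alpha> j * (p j \<bullet> p i) + \<beta> (Suc j) * (p (Suc j) \<bullet> p i)"
      using A_mult_q[OF j] p_carrier[of j] p_carrier[of "Suc j"] p_carrier[of i] i j
      by (simp add: add_scalar_prod_distrib[of _ m] smult_scalar_prod_distrib[of _ m])
    finally show ?thesis
      using IH[of j i] i j beta_pos[of "Suc j"] by (auto split: if_splits)
  qed
  have qq: "q (Suc j) \<bullet> q i = 0" if i: "i \<in> {1..j}" for i
  proof -
    have j: "1 \<le> j" "j < k" using i Suc.prems by auto
    have ci: "p i \<in> carrier_vec m" "p (Suc i) \<in> carrier_vec m" "p (Suc j) \<in> carrier_vec m"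
      using i p_carrier by auto
    have "p (Suc i) \<bullet> p (Suc j) = (if i = j then 1 else 0)"
    proof (cases "i = j")
      case True
      thus ?thesis using p_unit[of "Suc j"] j by simp
    next
      case False
      thus ?thesis using pp[of "Suc i"] i comm_scalar_prod[OF ci(2,3)] by simp
    qed
    hence "(A *\<^sub>v q i) \<bullet> p (Suc j) = (if i = j then \<beta> (Suc j) else 0)"
      using A_mult_q[of i] i j pp[of i] comm_scalar_prod[OF ci(1,3)] ci
      by (simp add: add_scalar_prod_distrib[of _ m] smult_scalar_prod_distrib[of _ m])
    moreover have "(A *\<^sub>v q i) \<bullet> p (Suc j) = q i \<bullet> (\<alpha> (Suc j) \<cdot>\<^sub>v q (Suc j) + \<beta> (Suc j) \<cdot>\<^sub>v q j)"
      using A_adjoint[of "Suc j" i] At_mult_p[of "Suc j"] j by auto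
    moreover have "\<dots> = \<alpha> (Suc j) * (q i \<bullet> q (Suc j)) + \<beta> (Suc j) * (q i \<bullet> q j)"
      using q_carrier
      by (simp add: scalar_prod_add_distrib[of _ n] scalar_prod_smult_distrib[of _ n])
    ultimately have "\<alpha> (Suc j) * (q i \<bullet> q (Suc j)) = 0"
      using IH(2)[of i j] i j by (auto split: if_splits)
    thus ?thesis
      using alpha_pos[of "Suc j"] j comm_scalar_prod[OF q_carrier[of i] q_carrier[of "Suc j"]] by simp
  qed
  consider "i \<in> {1..j}" "l \<in> {1..j}" | "i = Suc j" "l = Suc j"
    | "i = Suc j" "l \<in> {1..j}" | "i \<in> {1..j}" "l = Suc j"
    using Suc.prems by fastforce
  thus ?case
  proof cases
    case 1
    thus ?thesis using IH by simp
  next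
    case 2
    thus ?thesis using p_unit[of "Suc j"] q_unit[of "Suc j"] Suc.prems(1) by simp
  next
    case 3
    thus ?thesis using pp qq by auto
  next
    case 4
    have "p i \<in> carrier_vec m" "p l \<in> carrier_vec m"
      using 4 by (auto intro: p_carrier)
    hence "p i \<bullet> p l = 0"
      using pp[OF 4(1)] unfolding 4(2) by (metis comm_scalar_prod)
    moreover have "q i \<bullet> q l = 0"
      using qq[OF 4(1)] q_carrier unfolding 4(2) by (metis comm_scalar_prod)
    ultimately show ?thesis using 4 by simp
  qed
qed

lemmas orthonormal_p = orthonormal_upto[OF order.refl, THEN conjunct1]
lemmas orthonormal_q = orthonormal_upto[OF order.refl, THEN conjunct2]

section \<open>The projected problem\<close>

lemma P_carrier: "P \<in> carrier_mat m k" and Q_carrier: "Q \<in> carrier_mat n k"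
  using A by (auto simp: lb_P_def lb_Q_def)

lemma B_carrier: "B \<in> carrier_mat k k"
  using P_carrier Q_carrier A by (auto simp: lb_B_def)

lemma col_P: "i < k \<Longrightarrow> col P i = p (Suc i)"
  using p_carrier[of "Suc i"] A by (simp add: lb_P_def del: upt_Suc)

lemma col_Q: "i < k \<Longrightarrow> col Q i = q (Suc i)"
  using q_carrier[of "Suc i"] A by (simp add: lb_Q_def del: upt_Suc)

lemma PtP: "transpose_mat P * P = 1\<^sub>m k"
  using P_carrier by (intro eq_matI) (auto simp: col_P orthonormal_p)

lemma QtQ: "transpose_mat Q * Q = 1\<^sub>m k"
  using Q_carrier by (intro eq_matI) (auto simp: col_Q orthonormal_q)

text \<open>\<open>P P\<^sup>T\<close> and \<open>Q Q\<^sup>T\<close> fix the spans of the Lanczos vectors.\<close>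

lemma PPt_p:
  assumes "1 \<le> j" "j \<le> k"
  shows "P *\<^sub>v (transpose_mat P *\<^sub>v p j) = p j"
proof -
  have j: "j - 1 < k" using assms by simp
  have "P * (transpose_mat P * P) = P"
    using P_carrier by (simp add: PtP)
  hence "col (P * (transpose_mat P * P)) (j - 1) = p j"
    using col_P[OF j] assms by simp
  thus ?thesis
    using P_carrier j assms
    by (simp add: col_mult2[of _ m k _ k] col_mult2[of _ k m _ k] col_P del: col_mult)
qed

lemma QQt_q:
  assumes "j \<le> k"
  shows "Q *\<^sub>v (transpose_mat Q *\<^sub>v q j) = q j"
proof (cases "j = 0")
  case True
  thus ?thesis
    using Q_carrier A lb_initial(1)[of A b]
    by (simp add: mult_mat_zero_vec[of _ n k] mult_mat_zero_vec[of _ k n])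
next
  case False
  hence j: "j - 1 < k" using assms by simp
  have "Q * (transpose_mat Q * Q) = Q"
    using Q_carrier by (simp add: QtQ)
  hence "col (Q * (transpose_mat Q * Q)) (j - 1) = q j"
    using col_Q[OF j] False by simp
  thus ?thesis
    using Q_carrier j False
    by (simp add: col_mult2[of _ n k _ k] col_mult2[of _ k n _ k] col_Q del: col_mult)
qed

lemma B_index:
  assumes "i < k" "j < k"
  shows "B $$ (i, j) = (if i = j then \<alpha> (Suc j) else if i = Suc j then \<beta> (Suc i) else 0)"
proof -
  have Aq: "A *\<^sub>v q (Suc j) \<in> carrier_vec m" and Ap: "transpose_mat A *\<^sub>v p (Suc i) \<in> carrier_vec n"
    using A by (auto simp: carrier_dim_vec)
  have "B = transpose_mat P * (A * Q)"
    unfolding lb_B_def using P_carrier Q_carrier A by (intro assoc_mult_mat[of _ k m _ n _ k]) auto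
  also have "\<dots> $$ (i, j) = p (Suc i) \<bullet> (A *\<^sub>v q (Suc j))"
    using assms P_carrier Q_carrier A
    by (simp add: col_mult2[of _ m n _ k] col_P col_Q del: col_mult)
  also have "\<dots> = q (Suc j) \<bullet> (transpose_mat A *\<^sub>v p (Suc i))"
    using A_adjoint[of "Suc i" "Suc j"] comm_scalar_prod[OF Aq p_carrier[of "Suc i"]] by simp
  also have "\<dots> = \<alpha> (Suc i) * (q (Suc j) \<bullet> q (Suc i)) + \<beta> (Suc i) * (q (Suc j) \<bullet> q i)"
    using At_mult_p[of "Suc i"] assms q_carrier
    by (simp add: scalar_prod_add_distrib[of _ n] scalar_prod_smult_distrib[of _ n])
  also have "q (Suc j) \<bullet> q i = (if i = Suc j then 1 else 0)"
    using orthonormal_q[of "Suc j" i] assms q_carrier[of "Suc j"] lb_initial(1)[of A b] A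
    by (cases "i = 0") auto
  finally show ?thesis
    using orthonormal_q[of "Suc j" "Suc i"] assms by auto
qed

text \<open>This relation is exact because \<open>A\<^sup>T p\<^sub>j\<close> lies in the span of \<open>q\<^sub>j\<close> and \<open>q\<^sub>j\<^sub>-\<^sub>1\<close>.\<close>

lemma At_P: "transpose_mat A * P = Q * transpose_mat B"
proof -
  have tB: "transpose_mat B = transpose_mat Q * (transpose_mat A * P)"
    unfolding lb_B_def using P_carrier Q_carrier A
    by (subst transpose_mult[of _ k n _ k], auto, subst transpose_mult[of _ k m _ n], auto)
  have "col (transpose_mat A * P) i = col (Q * transpose_mat B) i" if i: "i < k" for i
  proof -
    have "col (Q * transpose_mat B) i = Q *\<^sub>v (transpose_mat Q *\<^sub>v (transpose_mat A *\<^sub>v p (Suc i)))"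
      unfolding tB using i P_carrier Q_carrier A
      by (simp add: col_mult2[of _ n k _ k] col_mult2[of _ k n _ k] col_mult2[of _ n m _ k] col_P
          del: col_mult)
    also have "transpose_mat A *\<^sub>v p (Suc i) = \<alpha> (Suc i) \<cdot>\<^sub>v q (Suc i) + \<beta> (Suc i) \<cdot>\<^sub>v q i"
      using At_mult_p[of "Suc i"] i by simp
    also have "Q *\<^sub>v (transpose_mat Q *\<^sub>v \<dots>) = \<dots>"
    proof -
      have "transpose_mat Q *\<^sub>v q j \<in> carrier_vec k" for j
        using Q_carrier by (simp add: carrier_dim_vec)
      thus ?thesis
        using i Q_carrier q_carrier
        by (simp add: mult_add_distrib_mat_vec[of _ k n] mult_add_distrib_mat_vec[of _ n k]
            mult_mat_vec[of _ k n] mult_mat_vec[of _ n k] QQt_q)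
    qed
    also have "\<dots> = col (transpose_mat A * P) i"
      using At_mult_p[of "Suc i"] i P_carrier A
      by (simp add: col_mult2[of _ n m _ k] col_P del: col_mult)
    finally show ?thesis ..
  qed
  thus ?thesis
    using P_carrier Q_carrier B_carrier A by (intro mat_col_eqI) auto
qed

text \<open>In contrast, \<open>A q\<^sub>k\<close> in general has a component along \<open>p\<^sub>k\<^sub>+\<^sub>1\<close>, so \<open>A Q\<close> and \<open>P B\<close> may differ in
  the last column, and the last entry of \<open>w\<close> must vanish.\<close>

lemma A_Q_mult_vec:
  assumes w: "w \<in> carrier_vec k" "w $ (k - 1) = 0"
  shows "A *\<^sub>v (Q *\<^sub>v w) = P *\<^sub>v (B *\<^sub>v w)"
proof -
  let ?N = "P * B"
  have B: "B = transpose_mat P * (A * Q)"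
    unfolding lb_B_def using P_carrier Q_carrier A by (intro assoc_mult_mat[of _ k m _ n _ k]) auto
  have N: "?N \<in> carrier_mat m k" and M: "A * Q \<in> carrier_mat m k"
    using P_carrier B_carrier A Q_carrier by auto
  have col_eq: "col (A * Q) j = col ?N j" if j: "Suc j < k" for j
  proof -
    have "col ?N j = P *\<^sub>v (transpose_mat P *\<^sub>v (A *\<^sub>v q (Suc j)))"
      unfolding B using j P_carrier Q_carrier A
      by (simp add: col_mult2[of _ m k _ k] col_mult2[of _ k m _ k] col_mult2[of _ m n _ k] col_Q
          del: col_mult)
    also have "A *\<^sub>v q (Suc j) = \<alpha> (Suc j) \<cdot>\<^sub>v p (Suc j) + \<beta> (Suc (Suc j)) \<cdot>\<^sub>v p (Suc (Suc j))"
      using A_mult_q[of "Suc j"] j by simp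
    also have "P *\<^sub>v (transpose_mat P *\<^sub>v \<dots>) = \<dots>"
    proof -
      have "transpose_mat P *\<^sub>v p j \<in> carrier_vec k" for j
        using P_carrier by (simp add: carrier_dim_vec)
      thus ?thesis
        using j P_carrier p_carrier
        by (simp add: mult_add_distrib_mat_vec[of _ k m] mult_add_distrib_mat_vec[of _ m k]
            mult_mat_vec[of _ k m] mult_mat_vec[of _ m k] PPt_p)
    qed
    also have "\<dots> = col (A * Q) j"
      using A_mult_q[of "Suc j"] j Q_carrier A
      by (simp add: col_mult2[of _ m n _ k] col_Q del: col_mult)
    finally show ?thesis ..
  qed
  have "(A * Q) *\<^sub>v w = ?N *\<^sub>v w"
  proof (rule eq_vecI)
    fix i assume "i < dim_vec (?N *\<^sub>v w)"
    hence i: "i < m" using N P_carrier by simp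
    have "(A * Q) $$ (i, j) * w $ j = ?N $$ (i, j) * w $ j" if "j < k" for j
    proof (cases "Suc j < k")
      case True
      have "(A * Q) $$ (i, j) = col (A * Q) j $ i"
        using i that by (subst index_col) (simp_all only: carrier_matD[OF M])
      also have "\<dots> = ?N $$ (i, j)"
        unfolding col_eq[OF True] using i that
        by (subst index_col) (simp_all only: carrier_matD[OF N])
      finally show ?thesis by simp
    next
      case False
      hence "j = k - 1" using that by simp
      thus ?thesis using w(2) by simp
    qed
    hence sums: "(\<Sum>j\<in>{0..<k}. (A * Q) $$ (i, j) * w $ j) = (\<Sum>j\<in>{0..<k}. ?N $$ (i, j) * w $ j)"
      by (intro sum.cong) auto
    have expand: "(M *\<^sub>v w) $ i = (\<Sum>j\<in>{0..<k}. M $$ (i, j) * w $ j)"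
      if "M \<in> carrier_mat m k" for M
      using that i w(1) by (auto simp: scalar_prod_def intro!: sum.cong)
    show "((A * Q) *\<^sub>v w) $ i = (?N *\<^sub>v w) $ i"
      unfolding expand[OF M] expand[OF N] by (rule sums)
  qed (use P_carrier A in auto)
  thus ?thesis
    unfolding assoc_mult_mat_vec[OF A Q_carrier w(1)]
      assoc_mult_mat_vec[OF P_carrier B_carrier w(1)] .
qed

text \<open>\<open>B\<^sup>T\<close> is upper triangular and \<open>B\<close> is lower bidiagonal: the former does not enlarge an initial
  range of indices that supports a vector, and the latter enlarges it by one.\<close>

lemma B_mult_support:
  assumes w: "w \<in> carrier_vec k" "\<And>i. j \<le> i \<Longrightarrow> i < k \<Longrightarrow> w $ i = 0"
  shows "\<And>i. j \<le> i \<Longrightarrow> i < k \<Longrightarrow> (transpose_mat B *\<^sub>v w) $ i = 0"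
    and "\<And>i. Suc j \<le> i \<Longrightarrow> i < k \<Longrightarrow> (B *\<^sub>v w) $ i = 0"
proof -
  fix i assume i: "j \<le> i" "i < k"
  have "(transpose_mat B *\<^sub>v w) $ i = (\<Sum>l\<in>{0..<k}. B $$ (l, i) * w $ l)"
    using i w B_carrier by (auto simp: scalar_prod_def intro!: sum.cong)
  also have "\<dots> = 0"
    using i w(2) by (intro sum.neutral) (auto simp: B_index)
  finally show "(transpose_mat B *\<^sub>v w) $ i = 0" .
next
  fix i assume i: "Suc j \<le> i" "i < k"
  have "(B *\<^sub>v w) $ i = (\<Sum>l\<in>{0..<k}. B $$ (i, l) * w $ l)"
    using i w B_carrier by (auto simp: scalar_prod_def intro!: sum.cong)
  also have "\<dots> = 0"
    using i w(2) by (intro sum.neutral) (auto simp: B_index)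
  finally show "(B *\<^sub>v w) $ i = 0" .
qed

lemma det_B: "det B \<noteq> 0"
proof -
  have "det B = prod_list (diag_mat B)"
    by (rule det_lower_triangular[OF _ B_carrier]) (auto simp: B_index)
  moreover have "B $$ (i, i) \<noteq> 0" if "i < k" for i
    using B_index[OF that that] alpha_pos[of "Suc i"] that by simp
  hence "0 \<notin> set (diag_mat B)"
    using carrier_matD(1)[OF B_carrier] by (auto simp: diag_mat_def)
  ultimately show ?thesis by (simp add: prod_list_zero_iff)
qed

lemma singular_values_B_nonzero:
  assumes "is_svd k k B X \<theta> Y" "l < k"
  shows "\<theta> l \<noteq> 0"
proof
  assume 0: "\<theta> l = 0"
  have c: "X \<in> carrier_mat k k" "Y \<in> carrier_mat k k" and YY: "transpose_mat Y * Y = 1\<^sub>m k"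
    using assms(1) unfolding is_svd_def real_orthogonal_def by blast+
  have y: "col Y l \<in> carrier_vec k" using c assms by auto
  have "B *\<^sub>v col Y l = 0\<^sub>v k"
    using is_svd_triplets(1)[OF assms(1) order.refl assms(2)] 0 c assms by auto
  moreover have "col Y l \<noteq> 0\<^sub>v k"
  proof
    assume z: "col Y l = 0\<^sub>v k"
    have "(transpose_mat Y * Y) $$ (l, l) = col Y l \<bullet> col Y l"
      using c assms by simp
    thus False using YY z assms by simp
  qed
  ultimately show False
    using det_0_iff_vec_prod_zero[OF B_carrier] det_B y by blast
qed

text \<open>The projected iterate after \<open>j\<close> steps is supported on the first \<open>j\<close> indices, which expresses that it
  lies in a Krylov space.  As long as \<open>j < k\<close> the last entry vanishes, and the projection makes no
  error in the next step.\<close>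

lemma richardson_projected:
  assumes "j \<le> k"
  defines "e \<equiv> \<beta> 1 \<cdot>\<^sub>v unit_vec k 0"
  shows "richardson A b \<theta> j = P *\<^sub>v richardson B e \<theta> j
    \<and> (\<forall>i. j \<le> i \<longrightarrow> i < k \<longrightarrow> richardson B e \<theta> j $ i = 0)"
  using assms(1)
proof (induction j)
  case 0
  thus ?case using P_carrier B_carrier A by (auto intro!: eq_vecI)
next
  case (Suc j)
  define h where "h = richardson B e \<theta> j"
  have e: "e \<in> carrier_vec k" by (simp add: e_def)
  have h: "h \<in> carrier_vec k"
    unfolding h_def by (rule richardson_carrier[OF B_carrier e])
  have IH: "richardson A b \<theta> j = P *\<^sub>v h" and supp: "\<And>i. j \<le> i \<Longrightarrow> i < k \<Longrightarrow> h $ i = 0"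
    using Suc by (auto simp: h_def)
  define w where "w = transpose_mat B *\<^sub>v h"
  have w: "w \<in> carrier_vec k" using B_carrier by (simp add: w_def carrier_dim_vec)
  have w0: "\<And>i. j \<le> i \<Longrightarrow> i < k \<Longrightarrow> w $ i = 0"
    unfolding w_def by (rule B_mult_support(1)[OF h supp])
  have Bw: "B *\<^sub>v w \<in> carrier_vec k" using B_carrier by (simp add: carrier_dim_vec)
  have "b = \<beta> 1 \<cdot>\<^sub>v p 1"
    using lb_initial[of A b] beta_pos[of 1] k_pos by (simp add: smult_smult_assoc)
  also have "\<dots> = P *\<^sub>v e"
    unfolding e_def using k_pos P_carrier
    by (simp add: mult_mat_vec[of _ m k] mult_mat_unit_vec[of _ m k] col_P)
  finally have b_eq: "b = P *\<^sub>v e" .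
  have "transpose_mat A *\<^sub>v (P *\<^sub>v h) = (transpose_mat A * P) *\<^sub>v h"
    using A P_carrier h by simp
  also have "\<dots> = Q *\<^sub>v w"
    unfolding At_P w_def using Q_carrier B_carrier h by simp
  finally have "transpose_mat A *\<^sub>v (P *\<^sub>v h) = Q *\<^sub>v w" .
  hence "A *\<^sub>v (transpose_mat A *\<^sub>v (P *\<^sub>v h)) = P *\<^sub>v (B *\<^sub>v w)"
    using A_Q_mult_vec[OF w] w0[of "k - 1"] Suc.prems by simp
  hence residual: "b - A *\<^sub>v (transpose_mat A *\<^sub>v (P *\<^sub>v h)) = P *\<^sub>v (e - B *\<^sub>v w)"
    using b_eq mult_minus_distrib_mat_vec[OF P_carrier e Bw] by simp
  have stepA: "richardson A b \<theta> (Suc j)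
      = P *\<^sub>v h + (1 / (\<theta> j)\<^sup>2) \<cdot>\<^sub>v (b - A *\<^sub>v (transpose_mat A *\<^sub>v (P *\<^sub>v h)))"
    by (simp only: richardson.simps IH)
  have stepB: "richardson B e \<theta> (Suc j) = h + (1 / (\<theta> j)\<^sup>2) \<cdot>\<^sub>v (e - B *\<^sub>v w)"
    by (simp only: richardson.simps h_def w_def)
  have d: "e - B *\<^sub>v w \<in> carrier_vec k"
    using e Bw by (rule minus_carrier_vec)
  show ?case
  proof (intro conjI allI impI)
    show "richardson A b \<theta> (Suc j) = P *\<^sub>v richardson B e \<theta> (Suc j)"
      unfolding stepA stepB residual mult_mat_vec[OF P_carrier d, symmetric]
      by (rule mult_add_distrib_mat_vec[OF P_carrier h, symmetric]) (use d in simp)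
  next
    fix i assume i: "Suc j \<le> i" "i < k"
    have "e $ i = 0"
      using i by (simp add: e_def)
    thus "richardson B e \<theta> (Suc j) $ i = 0"
      unfolding stepB using i h e B_carrier supp[of i] B_mult_support(2)[OF w w0 i] by simp
  qed
qed

section \<open>The filtered expansion\<close>

lemma cgme_x_eq_richardson:
  assumes svd: "is_svd k k B X \<theta> Y"
  shows "cgme_x A b k = transpose_mat A *\<^sub>v richardson A b \<theta> k"
proof -
  define e where "e = \<beta> 1 \<cdot>\<^sub>v unit_vec k 0"
  define g where "g = richardson B e \<theta> k"
  have e: "e \<in> carrier_vec k" by (simp add: e_def)
  have g: "g \<in> carrier_vec k"
    unfolding g_def by (rule richardson_carrier[OF B_carrier e])
  \<comment> \<open>Hence \<open>B\<^sup>T g\<close> solves \<open>B y = \<beta>\<^sub>1 e\<^sub>1\<close>, which is the system defining the CGME coefficients.\<close>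
  have solve: "B *\<^sub>v (transpose_mat B *\<^sub>v g) = e"
    unfolding g_def by (rule richardson_terminates[OF svd e singular_values_B_nonzero[OF svd]])
  have Btg: "transpose_mat B *\<^sub>v g \<in> carrier_vec k"
    by (rule mult_mat_vec_carrier[OF _ g]) (use B_carrier in simp)
  obtain C where C: "mat_inverse B = Some C"
    using mat_inverse(1)[OF B_carrier, of undefined] det_non_zero_imp_unit[OF B_carrier det_B]
    by fastforce
  have CB: "C * B = 1\<^sub>m k" and C_carrier: "C \<in> carrier_mat k k"
    using mat_inverse(2)[OF B_carrier C] by blast+
  have "cgme_y A b k = C *\<^sub>v e"
    unfolding cgme_y_def e_def C option.sel
    by (rule mult_mat_vec[OF C_carrier, symmetric]) simp
  also have "\<dots> = (C * B) *\<^sub>v (transpose_mat B *\<^sub>v g)"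
    unfolding assoc_mult_mat_vec[OF C_carrier B_carrier Btg] solve ..
  also have "\<dots> = transpose_mat B *\<^sub>v g"
    unfolding CB using Btg by (rule one_mult_mat_vec)
  finally have "cgme_x A b k = Q *\<^sub>v (transpose_mat B *\<^sub>v g)"
    unfolding cgme_x_def by (rule arg_cong)
  also have "\<dots> = (Q * transpose_mat B) *\<^sub>v g"
    by (rule assoc_mult_mat_vec[OF Q_carrier _ g, symmetric]) (use B_carrier in simp)
  also have "\<dots> = transpose_mat A *\<^sub>v (P *\<^sub>v g)"
    unfolding At_P[symmetric] by (rule assoc_mult_mat_vec[OF _ P_carrier g]) (use A in simp)
  also have "P *\<^sub>v g = richardson A b \<theta> k"
    using richardson_projected[of k \<theta>] by (simp add: g_def e_def)
  finally show ?thesis .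
qed

end

theorem theorem4p3:
  fixes A U V :: "real mat" and b :: "real vec" and \<sigma> \<theta> :: "nat \<Rightarrow> real" and m n k :: nat
  assumes "n \<le> m"
    and "A \<in> carrier_mat m n" and "b \<in> carrier_vec m"
    and "is_svd m n A U \<sigma> V"
    and "\<And>i j. i < j \<Longrightarrow> j < n \<Longrightarrow> \<sigma> j < \<sigma> i"
    and "\<And>i. i < n \<Longrightarrow> 0 < \<sigma> i"
    and "\<And>i. i < n \<Longrightarrow> col U i \<bullet> b \<noteq> 0"
    and "\<And>j. 1 \<le> j \<Longrightarrow> j \<le> n \<Longrightarrow> 0 < lb_alpha A b j"
    and "\<And>j. 2 \<le> j \<Longrightarrow> j \<le> n \<Longrightarrow> 0 < lb_beta A b j"
    and "n < m \<Longrightarrow> 0 < lb_beta A b (n + 1)"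
    and "1 \<le> k" and "k \<le> n"
    and "singular_values_of k (lb_B A b k) \<theta>"
  shows "cgme_x A b k =
    finsum_vec TYPE(real) n
      (\<lambda>i. (cgme_filter \<sigma> k \<theta> i * ((col U i \<bullet> b) / \<sigma> i)) \<cdot>\<^sub>v col V i) {..<n}"
proof -
  note svd = \<open>is_svd m n A U \<sigma> V\<close>
  have c: "U \<in> carrier_mat m m" "V \<in> carrier_mat n n" and V: "real_orthogonal n V"
    using svd unfolding is_svd_def real_orthogonal_def by blast+
  have "0 < vec_norm2 b"
  proof -
    have "col U 0 \<in> carrier_vec m"
      using c assms(1,11,12) by (intro col_carrier_vec[of 0 m]) auto
    hence "b \<noteq> 0\<^sub>v m"
      using assms(7)[of 0] assms(11,12) by auto
    thus ?thesis by (rule vec_norm2_pos[OF assms(3)])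
  qed
  have beta: "0 < lb_beta A b j" if "1 \<le> j" "j \<le> k" for j
  proof (cases "j = 1")
    case True
    with \<open>0 < vec_norm2 b\<close> show ?thesis by (simp only: lb_initial(2))
  next
    case False
    with that assms(12) show ?thesis by (intro assms(9)) auto
  qed
  interpret lanczos_bidiagonalization A b m n k
    using assms(2,3,8,11,12) beta by unfold_locales auto
  obtain X Y where svdB: "is_svd k k (lb_B A b k) X \<theta> Y"
    using assms(13) by (auto simp: singular_values_of_def)
  define g where "g = richardson A b \<theta> k"
  have g: "g \<in> carrier_vec m"
    unfolding g_def by (rule richardson_carrier[OF assms(2,3)])
  have x: "cgme_x A b k = transpose_mat A *\<^sub>v g"
    unfolding g_def by (rule cgme_x_eq_richardson[OF svdB])
  have xc: "transpose_mat A *\<^sub>v g \<in> carrier_vec n" "A *\<^sub>v (transpose_mat A *\<^sub>v g) \<in> carrier_vec m"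
    using assms(2) g by (auto intro!: mult_mat_vec_carrier[of _ m n] mult_mat_vec_carrier[of _ n m])
  have coeff: "col V i \<bullet> (transpose_mat A *\<^sub>v g)
      = cgme_filter \<sigma> k \<theta> i * ((col U i \<bullet> b) / \<sigma> i)" if i: "i < n" for i
  proof -
    have u: "col U i \<in> carrier_vec m" using c i assms(1) by auto
    \<comment> \<open>Both sides are the component along \<open>u\<^sub>i\<close> of the Richardson residual \<open>b - A A\<^sup>T g\<close>.\<close>
    have "col U i \<bullet> b - \<sigma> i * (col V i \<bullet> (transpose_mat A *\<^sub>v g))
        = (1 - cgme_filter \<sigma> k \<theta> i) * (col U i \<bullet> b)"
      using richardson_residual[OF svd assms(1) i assms(3), of k \<theta>]
        singular_values_B_nonzero[OF svdB] is_svd_coefficients(1)[OF svd assms(1) i xc(1)]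
      by (simp add: scalar_prod_minus_distrib[OF u assms(3) xc(2)] cgme_filter_def flip: g_def)
    thus ?thesis
      using assms(6)[OF i] by (simp add: field_simps)
  qed
  have Vc: "(\<lambda>i. f i \<cdot>\<^sub>v col V i) \<in> {..<n} \<rightarrow> carrier_vec n" for f
    using c by auto
  let ?S = "finsum_vec TYPE(real) n
    (\<lambda>i. (cgme_filter \<sigma> k \<theta> i * ((col U i \<bullet> b) / \<sigma> i)) \<cdot>\<^sub>v col V i) {..<n}"
  have S: "dim_vec ?S = n"
    by (rule carrier_vecD[OF finsum_vec_closed[OF Vc]])
  show ?thesis
  proof (rule eq_vecI)
    show "dim_vec (cgme_x A b k) = dim_vec ?S"
      unfolding x S by (rule carrier_vecD[OF xc(1)])
    fix j assume "j < dim_vec ?S"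
    hence j: "j < n" unfolding S .
    show "cgme_x A b k $ j = ?S $ j"
      unfolding x real_orthogonal_expansion[OF V xc(1) j] index_finsum_vec[OF finite_lessThan j Vc]
      using c j by (intro sum.cong) (auto simp: coeff)
  qed
qed

end
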